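(* Let $(V,\alpha_{V_0},\beta_{V_1})$, $(\mathfrak{a},\alpha,\beta)$ and $(\widetilde{\mathfrak{a}},\widetilde\alpha,\widetilde\beta)$ be Hom-Lie antialgebras. Every central extension $$0\to V\xrightarrow{\ i\ }\widetilde{\mathfrak{a}}\xrightarrow{\ \pi\ }\mathfrak{a}\to0$$ of $\mathfrak{a}$ by $V$ gives rise to a crossed module $(\widetilde{\mathfrak{a}},\mathfrak{a},\pi)$; that is, there is an action of $\mathfrak{a}$ over $\widetilde{\mathfrak{a}}$ for which the projection $\pi:\widetilde{\mathfrak{a}}\to\mathfrak{a}$ is a crossed module of Hom-Lie antialgebras.
   Context: All vector spaces are over an algebraically closed field of characteristic $0$. Maps between $\mathbb{Z}_2$-graded spaces are grade-preserving linear maps. **Hom-Lie antialgebra.** A Hom-Lie antialgebra $(\mathfrak{a},\alpha,\beta)$ is a $\mathbb{Z}_2$-graded vector space $\mathfrak{a}=\mathfrak{a}_0\oplus\mathfrak{a}_1$ with bilinear operations $\cdot:\mathfrak{a}_0\times\mathfrak{a}_0\to\mathfrak{a}_0$, $\cdot:\mathfrak{a}_0\times\mathfrak{a}_1\to\mathfrak{a}_1$, $[\,,]:\mathfrak{a}_1\times\mathfrak{a}_1\to\mathfrak{a}_0$ and linear maps $\alpha:\mathfrak{a}_0\to\mathfrak{a}_0$, $\beta:\mathfrak{a}_1\to\mathfrak{a}_1$. It is supercommutative: $x_1\cdot x_2=x_2\cdot x_1$, $x_1\cdot y_1=y_1\cdot x_1$, $[y_1,y_2]=-[y_2,y_1]$.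 Moreover, for all $x_i\in\mathfrak{a}_0$, $y_i\in\mathfrak{a}_1$: $\alpha(x_1)\cdot(x_2\cdot x_3)=(x_1\cdot x_2)\cdot\alpha(x_3)$; $\alpha(x_1)\cdot(x_2\cdot y_1)=\frac12(x_1\cdot x_2)\cdot\beta(y_1)$; $\alpha(x_1)\cdot[y_1,y_2]=[x_1\cdot y_1,\beta(y_2)]+[\beta(y_1),x_1\cdot y_2]$; $\beta(y_1)\cdot[y_2,y_3]+\beta(y_2)\cdot[y_3,y_1]+\beta(y_3)\cdot[y_1,y_2]=0$. **Homomorphism.** A homomorphism $\phi=(\phi_0,\phi_1):(\mathfrak{a},\alpha,\beta)\to(\mathfrak{a}',\alpha',\beta')$ consists of linear maps $\phi_i:\mathfrak{a}_i\to\mathfrak{a}'_i$ with $\phi_0\alpha=\alpha'\phi_0$, $\phi_1\beta=\beta'\phi_1$, $\phi_0(x_1\cdot x_2)=\phi_0(x_1)\cdot\phi_0(x_2)$, $\phi_1(x_1\cdot y_1)=\phi_0(x_1)\cdot\phi_1(y_1)$, $\phi_0([y_1,y_2])=[\phi_1(y_1),\phi_1(y_2)]$. **Central extension.** The center $Z(\mathfrak{a})=Z_0\oplus Z_1$ is given by $Z_0=\{x\in\mathfrak{a}_0: x\cdot x'=0,\ x\cdot y'=0\ \forall x'\in\mathfrak{a}_0,y'\in\mathfrak{a}_1\}$ and $Z_1=\{y\in\mathfrak{a}_1: x'\cdot y=0,\ [y,y']=0\ \forall x'\in\mathfrak{a}_0,y'\in\mathfrak{a}_1\}$. A central extension of $\mathfrak{a}$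 by $V$ is a short exact sequence $0\to V\xrightarrow{i}\widetilde{\mathfrak{a}}\xrightarrow{\pi}\mathfrak{a}\to0$ of Hom-Lie antialgebras and homomorphisms with (the image of) $V$ contained in $Z(\widetilde{\mathfrak{a}})$. **Representation.** A representation of $(\mathfrak{a},\alpha,\beta)$ on a $\mathbb{Z}_2$-graded space $V=V_0\oplus V_1$ with linear maps $\alpha_{V_0}:V_0\to V_0$, $\beta_{V_1}:V_1\to V_1$ is a pair $\rho=(\rho_0,\rho_1)$, where $\rho_0$ assigns linearly to $x\in\mathfrak{a}_0$ a linear map $\rho_0(x):V\to V$ preserving $V_0$ and $V_1$, and $\rho_1$ assigns linearly to $y\in\mathfrak{a}_1$ a linear map $\rho_1(y):V\to V$ exchanging $V_0$ and $V_1$. It is required that $\mathfrak{a}\oplus V$ be a Hom-Lie antialgebra with the maps $(x,u)\mapsto(\alpha(x),\alpha_{V_0}(u))$, $(y,v)\mapsto(\beta(y),\beta_{V_1}(v))$ and the products $(x_1,u_1)\cdot(x_2,u_2)=(x_1\cdot x_2,\rho_0(x_1)(u_2)+\rho_0(x_2)(u_1))$, $(x_1,u_1)\cdot(y_1,v_1)=(x_1\cdot y_1,\rho_0(x_1)(v_1)+\rho_1(y_1)(u_1))$, $[(y_1,v_1),(y_2,v_2)]=([y_1,y_2],\rho_1(y_1)(v_2)-\rho_1(y_2)(v_1))$. **Action.** Let $(V,\alpha_{V_0},\beta_{V_1})$ and $(\mathfrak{a},\alpha,\beta)$ be Hom-Lie antialgebras. An action of $\mathfrak{a}$ over $V$ is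 a representation $\rho$ of $\mathfrak{a}$ on $V$ such that for all $x_1\in\mathfrak{a}_0$, $y_1\in\mathfrak{a}_1$, $u_i\in V_0$, $v_i\in V_1$: $\rho_0(\alpha(x_1))(u_1\cdot u_2)=\rho_0(x_1)(u_1)\cdot\alpha_{V_0}(u_2)$; $\rho_0(\alpha(x_1))(u_1\cdot v_1)=\frac12\rho_0(x_1)(u_1)\cdot\beta_{V_1}(v_1)$; $\rho_1(y_1)(u_2)\cdot\alpha_{V_0}(u_1)=\frac12\rho_1(\beta(y_1))(u_1\cdot u_2)$; $\rho_0(x_1)(v_1)\cdot\alpha_{V_0}(u_1)=\frac12\rho_0(x_1)(u_1)\cdot\beta_{V_1}(v_1)$; $\rho_0(\alpha(x_1))([v_1,v_2])=[\rho_0(x_1)(v_1),\beta_{V_1}(v_2)]+[\beta_{V_1}(v_1),\rho_0(x_1)(v_2)]$; $\rho_1(\beta(y_1))(u_1\cdot v_1)=\alpha_{V_0}(u_1)\cdot\rho_1(y_1)(v_1)-[\rho_1(y_1)(u_1),\beta_{V_1}(v_1)]$; $\rho_1(\beta(y_1))([v_1,v_2])=\beta_{V_1}(v_1)\cdot\rho_1(y_1)(v_2)-\beta_{V_1}(v_2)\cdot\rho_1(y_1)(v_1)$. **Crossed module.** Given an action $\rho$ of $\mathfrak{a}$ over $V$, a crossed module $(V,\mathfrak{a},\partial)$ is a homomorphism $\partial=(\partial_0,\partial_1):V\to\mathfrak{a}$ of Hom-Lie antialgebras such that for all $x_1\in\mathfrak{a}_0$, $y_1\in\mathfrak{a}_1$,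 $u_i\in V_0$, $v_i\in V_1$: $\partial_0(\rho_0(x_1)(u_1))=x_1\cdot\partial_0(u_1)$; $\partial_1(\rho_0(x_1)(v_1))=x_1\cdot\partial_1(v_1)$; $\partial_1(\rho_1(y_1)(u_1))=y_1\cdot\partial_0(u_1)$; $\partial_0(\rho_1(y_1)(v_1))=[y_1,\partial_1(v_1)]$; $\rho_0(\partial_0(u_1))(u_2)=u_1\cdot u_2$; $\rho_1(\partial_1(v_1))(v_2)=[v_1,v_2]$; $\rho_0(\partial_0(u_1))(v_1)=\rho_1(\partial_1(v_1))(u_1)=u_1\cdot v_1$. *)

theory Defs
  imports "HOL-Computational_Algebra.Polynomial" "HOL-Library.Product_Plus"
begin

text \<open>
  A \<open>\<int>\<^sub>2\<close>-graded vector space is given by its two homogeneous components, each a type with its own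
  scalar multiplication (\<^locale>\<open>vector_space\<close>); the total space is the product type, with the even
  component embedded as \<open>UNIV \<times> {0}\<close> and the odd one as \<open>{0} \<times> UNIV\<close>.
  The products of an odd element with an even one are not separate data: by supercommutativity
  \<open>y \<cdot> x\<close> is always written \<open>x \<cdot> y\<close>, i.e. \<open>mult01 A x y\<close>.
\<close>

record ('k, 'a0, 'a1) graded_hom_alg =
  scale0 :: "'k \<Rightarrow> 'a0 \<Rightarrow> 'a0"
  scale1 :: "'k \<Rightarrow> 'a1 \<Rightarrow> 'a1"
  mult00 :: "'a0 \<Rightarrow> 'a0 \<Rightarrow> 'a0"
  mult01 :: "'a0 \<Rightarrow> 'a1 \<Rightarrow> 'a1"
  brack :: "'a1 \<Rightarrow> 'a1 \<Rightarrow> 'a0"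
  twist0 :: "'a0 \<Rightarrow> 'a0"
  twist1 :: "'a1 \<Rightarrow> 'a1"

definition bilinear_map ::
  "('k::field \<Rightarrow> 'a::ab_group_add \<Rightarrow> 'a) \<Rightarrow> ('k \<Rightarrow> 'b::ab_group_add \<Rightarrow> 'b) \<Rightarrow>
   ('k \<Rightarrow> 'c::ab_group_add \<Rightarrow> 'c) \<Rightarrow> ('a \<Rightarrow> 'b \<Rightarrow> 'c) \<Rightarrow> bool"
  where "bilinear_map s1 s2 s3 f \<longleftrightarrow>
    (\<forall>x. Vector_Spaces.linear s2 s3 (f x)) \<and> (\<forall>y. Vector_Spaces.linear s1 s3 (\<lambda>x. f x y))"

definition prod_scale :: "('k \<Rightarrow> 'a \<Rightarrow> 'a) \<Rightarrow> ('k \<Rightarrow> 'b \<Rightarrow> 'b) \<Rightarrow> 'k \<Rightarrow> 'a \<times> 'b \<Rightarrow> 'a \<times> 'b"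
  where "prod_scale s1 s2 c = map_prod (s1 c) (s2 c)"

locale hom_lie_antialgebra =
  fixes A :: "('k::{alg_closed_field,field_char_0}, 'a0::ab_group_add, 'a1::ab_group_add)
    graded_hom_alg"
  assumes vector_space0: "vector_space (scale0 A)"
    and vector_space1: "vector_space (scale1 A)"
    and bilinear00: "bilinear_map (scale0 A) (scale0 A) (scale0 A) (mult00 A)"
    and bilinear01: "bilinear_map (scale0 A) (scale1 A) (scale1 A) (mult01 A)"
    and bilinear_brack: "bilinear_map (scale1 A) (scale1 A) (scale0 A) (brack A)"
    and linear_twist0: "Vector_Spaces.linear (scale0 A) (scale0 A) (twist0 A)"
    and linear_twist1: "Vector_Spaces.linear (scale1 A) (scale1 A) (twist1 A)"
    and mult00_commute: "mult00 A x1 x2 = mult00 A x2 x1"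
    and brack_skew: "brack A y1 y2 = - brack A y2 y1"
    and hom_assoc00:
      "mult00 A (twist0 A x1) (mult00 A x2 x3) = mult00 A (mult00 A x1 x2) (twist0 A x3)"
    and hom_assoc01:
      "mult01 A (twist0 A x1) (mult01 A x2 y1)
        = scale1 A (1/2) (mult01 A (mult00 A x1 x2) (twist1 A y1))"
    and hom_derivation:
      "mult00 A (twist0 A x1) (brack A y1 y2)
        = brack A (mult01 A x1 y1) (twist1 A y2) + brack A (twist1 A y1) (mult01 A x1 y2)"
    and hom_jacobi:
      "mult01 A (brack A y2 y3) (twist1 A y1) + mult01 A (brack A y3 y1) (twist1 A y2)
        + mult01 A (brack A y1 y2) (twist1 A y3) = 0"

definition hla_hom ::
  "('k::{alg_closed_field,field_char_0}, 'a0::ab_group_add, 'a1::ab_group_add) graded_hom_alg \<Rightarrow>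
   ('k, 'b0::ab_group_add, 'b1::ab_group_add) graded_hom_alg \<Rightarrow>
   ('a0 \<Rightarrow> 'b0) \<Rightarrow> ('a1 \<Rightarrow> 'b1) \<Rightarrow> bool"
  where "hla_hom A B \<phi>0 \<phi>1 \<longleftrightarrow>
    Vector_Spaces.linear (scale0 A) (scale0 B) \<phi>0 \<and>
    Vector_Spaces.linear (scale1 A) (scale1 B) \<phi>1 \<and>
    (\<forall>x. \<phi>0 (twist0 A x) = twist0 B (\<phi>0 x)) \<and>
    (\<forall>y. \<phi>1 (twist1 A y) = twist1 B (\<phi>1 y)) \<and>
    (\<forall>x1 x2. \<phi>0 (mult00 A x1 x2) = mult00 B (\<phi>0 x1) (\<phi>0 x2)) \<and>
    (\<forall>x y. \<phi>1 (mult01 A x y) = mult01 B (\<phi>0 x) (\<phi>1 y)) \<and>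
    (\<forall>y1 y2. \<phi>0 (brack A y1 y2) = brack B (\<phi>1 y1) (\<phi>1 y2))"

definition center0 :: "('k, 'a0::zero, 'a1::zero) graded_hom_alg \<Rightarrow> 'a0 set"
  where "center0 A = {x. (\<forall>x'. mult00 A x x' = 0) \<and> (\<forall>y'. mult01 A x y' = 0)}"

definition center1 :: "('k, 'a0::zero, 'a1::zero) graded_hom_alg \<Rightarrow> 'a1 set"
  where "center1 A = {y. (\<forall>x'. mult01 A x' y = 0) \<and> (\<forall>y'. brack A y y' = 0)}"

definition central_extension ::
  "('k::{alg_closed_field,field_char_0}, 'v0::ab_group_add, 'v1::ab_group_add) graded_hom_alg \<Rightarrow>
   ('k, 'e0::ab_group_add, 'e1::ab_group_add) graded_hom_alg \<Rightarrow>
   ('k, 'a0::ab_group_add, 'a1::ab_group_add) graded_hom_alg \<Rightarrow>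
   ('v0 \<Rightarrow> 'e0) \<Rightarrow> ('v1 \<Rightarrow> 'e1) \<Rightarrow> ('e0 \<Rightarrow> 'a0) \<Rightarrow> ('e1 \<Rightarrow> 'a1) \<Rightarrow> bool"
  where "central_extension V E A i0 i1 \<pi>0 \<pi>1 \<longleftrightarrow>
    hom_lie_antialgebra V \<and> hom_lie_antialgebra E \<and> hom_lie_antialgebra A \<and>
    hla_hom V E i0 i1 \<and> hla_hom E A \<pi>0 \<pi>1 \<and>
    inj i0 \<and> inj i1 \<and>
    range i0 = {x. \<pi>0 x = 0} \<and> range i1 = {y. \<pi>1 y = 0} \<and>
    surj \<pi>0 \<and> surj \<pi>1 \<and>
    range i0 \<subseteq> center0 E \<and> range i1 \<subseteq> center1 E"

text \<open>
  The homogeneous components of an endomap \<open>f\<close> of \<open>V = V\<^sub>0 \<oplus> V\<^sub>1\<close>, e.g. \<open>comp01 f\<close> is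
  the component \<open>V\<^sub>0 \<rightarrow> V\<^sub>1\<close>.
\<close>

definition comp00 :: "('v0::zero \<times> 'v1::zero \<Rightarrow> 'v0 \<times> 'v1) \<Rightarrow> 'v0 \<Rightarrow> 'v0"
  where "comp00 f u = fst (f (u, 0))"

definition comp11 :: "('v0::zero \<times> 'v1::zero \<Rightarrow> 'v0 \<times> 'v1) \<Rightarrow> 'v1 \<Rightarrow> 'v1"
  where "comp11 f v = snd (f (0, v))"

definition comp01 :: "('v0::zero \<times> 'v1::zero \<Rightarrow> 'v0 \<times> 'v1) \<Rightarrow> 'v0 \<Rightarrow> 'v1"
  where "comp01 f u = snd (f (u, 0))"

definition comp10 :: "('v0::zero \<times> 'v1::zero \<Rightarrow> 'v0 \<times> 'v1) \<Rightarrow> 'v1 \<Rightarrow> 'v0"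
  where "comp10 f v = fst (f (0, v))"

definition semidirect ::
  "('k, 'a0, 'a1) graded_hom_alg \<Rightarrow>
   ('k \<Rightarrow> 'v0::ab_group_add \<Rightarrow> 'v0) \<Rightarrow> ('k \<Rightarrow> 'v1::ab_group_add \<Rightarrow> 'v1) \<Rightarrow>
   ('v0 \<Rightarrow> 'v0) \<Rightarrow> ('v1 \<Rightarrow> 'v1) \<Rightarrow>
   ('a0 \<Rightarrow> 'v0 \<times> 'v1 \<Rightarrow> 'v0 \<times> 'v1) \<Rightarrow> ('a1 \<Rightarrow> 'v0 \<times> 'v1 \<Rightarrow> 'v0 \<times> 'v1) \<Rightarrow>
   ('k, 'a0 \<times> 'v0, 'a1 \<times> 'v1) graded_hom_alg"
  where "semidirect A s0 s1 \<alpha>V \<beta>V \<rho>0 \<rho>1 =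
    \<lparr> scale0 = prod_scale (scale0 A) s0,
      scale1 = prod_scale (scale1 A) s1,
      mult00 = (\<lambda>(x1, u1) (x2, u2). (mult00 A x1 x2, comp00 (\<rho>0 x1) u2 + comp00 (\<rho>0 x2) u1)),
      mult01 = (\<lambda>(x1, u1) (y1, v1). (mult01 A x1 y1, comp11 (\<rho>0 x1) v1 + comp01 (\<rho>1 y1) u1)),
      brack = (\<lambda>(y1, v1) (y2, v2). (brack A y1 y2, comp10 (\<rho>1 y1) v2 - comp10 (\<rho>1 y2) v1)),
      twist0 = map_prod (twist0 A) \<alpha>V,
      twist1 = map_prod (twist1 A) \<beta>V \<rparr>"

definition representation ::
  "('k::{alg_closed_field,field_char_0}, 'a0::ab_group_add, 'a1::ab_group_add) graded_hom_alg \<Rightarrow>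
   ('k \<Rightarrow> 'v0::ab_group_add \<Rightarrow> 'v0) \<Rightarrow> ('k \<Rightarrow> 'v1::ab_group_add \<Rightarrow> 'v1) \<Rightarrow>
   ('v0 \<Rightarrow> 'v0) \<Rightarrow> ('v1 \<Rightarrow> 'v1) \<Rightarrow>
   ('a0 \<Rightarrow> 'v0 \<times> 'v1 \<Rightarrow> 'v0 \<times> 'v1) \<Rightarrow> ('a1 \<Rightarrow> 'v0 \<times> 'v1 \<Rightarrow> 'v0 \<times> 'v1) \<Rightarrow> bool"
  where "representation A s0 s1 \<alpha>V \<beta>V \<rho>0 \<rho>1 \<longleftrightarrow>
    hom_lie_antialgebra A \<and> vector_space s0 \<and> vector_space s1 \<and>
    Vector_Spaces.linear s0 s0 \<alpha>V \<and> Vector_Spaces.linear s1 s1 \<beta>V \<and>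
    bilinear_map (scale0 A) (prod_scale s0 s1) (prod_scale s0 s1) \<rho>0 \<and>
    bilinear_map (scale1 A) (prod_scale s0 s1) (prod_scale s0 s1) \<rho>1 \<and>
    (\<forall>x. \<rho>0 x ` (UNIV \<times> {0}) \<subseteq> UNIV \<times> {0} \<and> \<rho>0 x ` ({0} \<times> UNIV) \<subseteq> {0} \<times> UNIV) \<and>
    (\<forall>y. \<rho>1 y ` (UNIV \<times> {0}) \<subseteq> {0} \<times> UNIV \<and> \<rho>1 y ` ({0} \<times> UNIV) \<subseteq> UNIV \<times> {0}) \<and>
    hom_lie_antialgebra (semidirect A s0 s1 \<alpha>V \<beta>V \<rho>0 \<rho>1)"

definition hla_action ::
  "('k::{alg_closed_field,field_char_0}, 'a0::ab_group_add, 'a1::ab_group_add) graded_hom_alg \<Rightarrow>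
   ('k, 'v0::ab_group_add, 'v1::ab_group_add) graded_hom_alg \<Rightarrow>
   ('a0 \<Rightarrow> 'v0 \<times> 'v1 \<Rightarrow> 'v0 \<times> 'v1) \<Rightarrow> ('a1 \<Rightarrow> 'v0 \<times> 'v1 \<Rightarrow> 'v0 \<times> 'v1) \<Rightarrow> bool"
  where "hla_action A V \<rho>0 \<rho>1 \<longleftrightarrow>
    hom_lie_antialgebra A \<and> hom_lie_antialgebra V \<and>
    representation A (scale0 V) (scale1 V) (twist0 V) (twist1 V) \<rho>0 \<rho>1 \<and>
    (\<forall>x1 u1 u2. comp00 (\<rho>0 (twist0 A x1)) (mult00 V u1 u2)
        = mult00 V (comp00 (\<rho>0 x1) u1) (twist0 V u2)) \<and>
    (\<forall>x1 u1 v1. comp11 (\<rho>0 (twist0 A x1)) (mult01 V u1 v1)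
        = scale1 V (1/2) (mult01 V (comp00 (\<rho>0 x1) u1) (twist1 V v1))) \<and>
    (\<forall>y1 u1 u2. mult01 V (twist0 V u1) (comp01 (\<rho>1 y1) u2)
        = scale1 V (1/2) (comp01 (\<rho>1 (twist1 A y1)) (mult00 V u1 u2))) \<and>
    (\<forall>x1 u1 v1. mult01 V (twist0 V u1) (comp11 (\<rho>0 x1) v1)
        = scale1 V (1/2) (mult01 V (comp00 (\<rho>0 x1) u1) (twist1 V v1))) \<and>
    (\<forall>x1 v1 v2. comp00 (\<rho>0 (twist0 A x1)) (brack V v1 v2)
        = brack V (comp11 (\<rho>0 x1) v1) (twist1 V v2)
          + brack V (twist1 V v1) (comp11 (\<rho>0 x1) v2)) \<and>
    (\<forall>y1 u1 v1. comp10 (\<rho>1 (twist1 A y1)) (mult01 V u1 v1)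
        = mult00 V (twist0 V u1) (comp10 (\<rho>1 y1) v1)
          - brack V (comp01 (\<rho>1 y1) u1) (twist1 V v1)) \<and>
    (\<forall>y1 v1 v2. comp01 (\<rho>1 (twist1 A y1)) (brack V v1 v2)
        = mult01 V (comp10 (\<rho>1 y1) v2) (twist1 V v1)
          - mult01 V (comp10 (\<rho>1 y1) v1) (twist1 V v2))"

definition crossed_module ::
  "('k::{alg_closed_field,field_char_0}, 'v0::ab_group_add, 'v1::ab_group_add) graded_hom_alg \<Rightarrow>
   ('k, 'a0::ab_group_add, 'a1::ab_group_add) graded_hom_alg \<Rightarrow>
   ('a0 \<Rightarrow> 'v0 \<times> 'v1 \<Rightarrow> 'v0 \<times> 'v1) \<Rightarrow> ('a1 \<Rightarrow> 'v0 \<times> 'v1 \<Rightarrow> 'v0 \<times> 'v1) \<Rightarrow>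
   ('v0 \<Rightarrow> 'a0) \<Rightarrow> ('v1 \<Rightarrow> 'a1) \<Rightarrow> bool"
  where "crossed_module V A \<rho>0 \<rho>1 d0 d1 \<longleftrightarrow>
    hla_action A V \<rho>0 \<rho>1 \<and> hla_hom V A d0 d1 \<and>
    (\<forall>x1 u1. d0 (comp00 (\<rho>0 x1) u1) = mult00 A x1 (d0 u1)) \<and>
    (\<forall>x1 v1. d1 (comp11 (\<rho>0 x1) v1) = mult01 A x1 (d1 v1)) \<and>
    (\<forall>y1 u1. d1 (comp01 (\<rho>1 y1) u1) = mult01 A (d0 u1) y1) \<and>
    (\<forall>y1 v1. d0 (comp10 (\<rho>1 y1) v1) = brack A y1 (d1 v1)) \<and>
    (\<forall>u1 u2. comp00 (\<rho>0 (d0 u1)) u2 = mult00 V u1 u2) \<and>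
    (\<forall>v1 v2. comp10 (\<rho>1 (d1 v1)) v2 = brack V v1 v2) \<and>
    (\<forall>u1 v1. comp11 (\<rho>0 (d0 u1)) v1 = mult01 V u1 v1
        \<and> comp01 (\<rho>1 (d1 v1)) u1 = mult01 V u1 v1)"

end

theory Submission
  imports Defs
begin

text \<open>
  Since the kernel of \<open>\<pi>\<close> is central, a product in \<open>E\<close> depends only on the \<open>\<pi>\<close>-images of its
  factors. Hence \<open>A\<close> acts on \<open>E\<close> by multiplication with arbitrary (not necessarily linear)
  \<open>\<pi>\<close>-preimages, and each axiom of an action is an instance of an axiom of \<open>E\<close>.
\<close>

section \<open>Product spaces and bilinear maps in equational form\<close>

lemma vector_space_prod_scale:
  assumes "vector_space s1" and "vector_space s2"
  shows "vector_space (prod_scale s1 s2)"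
  using assms unfolding vector_space_def prod_scale_def by (auto simp: plus_prod_def)

lemma bilinear_map_iff:
  "bilinear_map s1 s2 s3 f \<longleftrightarrow> vector_space s1 \<and> vector_space s2 \<and> vector_space s3 \<and>
    (\<forall>x y z. f (x + y) z = f x z + f y z) \<and> (\<forall>x y z. f x (y + z) = f x y + f x z) \<and>
    (\<forall>c x y. f (s1 c x) y = s3 c (f x y)) \<and> (\<forall>c x y. f x (s2 c y) = s3 c (f x y))"
  unfolding bilinear_map_def Vector_Spaces.linear_iff by blast

lemma bilinear_map_group_rules:
  assumes "bilinear_map s1 s2 s3 f"
  shows "f (x - y) z = f x z - f y z" "f x (u - v) = f x u - f x v" "f 0 v = 0" "f x 0 = 0"
    "f (- x) z = - f x z" "f x (- v) = - f x v"
proof -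
  have l: "f (x + y) z = f x z + f y z" and r: "f w (u + v) = f w u + f w v" for x y z w u v
    using assms by (auto simp: bilinear_map_iff)
  show dl: "f (x - y) z = f x z - f y z" for x y z using l[of "x - y" y z] by (simp add: algebra_simps)
  show dr: "f x (u - v) = f x u - f x v" for x u v using r[of x "u - v" v] by (simp add: algebra_simps)
  show zl: "f 0 v = 0" for v using l[of 0 0 v] by simp
  show zr: "f x 0 = 0" for x using r[of x 0 0] by simp
  show "f (- x) z = - f x z" using dl[of 0 x z] zl by simp
  show "f x (- v) = - f x v" using dr[of x 0 v] zr by simp
qed

section \<open>Linearity rules inside one Hom-Lie antialgebra\<close>

context hom_lie_antialgebra
begin

lemma scale_rules:
  "scale0 A c (x + x') = scale0 A c x + scale0 A c x'"
  "scale1 A c (y + y') = scale1 A c y + scale1 A c y'"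
  "scale0 A c (x - x') = scale0 A c x - scale0 A c x'"
  "scale1 A c (y - y') = scale1 A c y - scale1 A c y'"
  "scale0 A c 0 = 0" "scale1 A c 0 = 0"
proof -
  interpret v0: vector_space "scale0 A" by (rule vector_space0)
  interpret v1: vector_space "scale1 A" by (rule vector_space1)
  show "scale0 A c (x + x') = scale0 A c x + scale0 A c x'"
    "scale1 A c (y + y') = scale1 A c y + scale1 A c y'"
    "scale0 A c (x - x') = scale0 A c x - scale0 A c x'"
    "scale1 A c (y - y') = scale1 A c y - scale1 A c y'"
    "scale0 A c 0 = 0" "scale1 A c 0 = 0"
    by (simp_all add: v0.scale_right_distrib v1.scale_right_distrib
        v0.scale_right_diff_distrib v1.scale_right_diff_distrib)
qed

lemma product_rules:
  "mult00 A (x + x') z = mult00 A x z + mult00 A x' z"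
  "mult00 A z (x + x') = mult00 A z x + mult00 A z x'"
  "mult00 A (scale0 A c x) z = scale0 A c (mult00 A x z)"
  "mult00 A z (scale0 A c x) = scale0 A c (mult00 A z x)"
  "mult01 A (x + x') y = mult01 A x y + mult01 A x' y"
  "mult01 A x (y + y') = mult01 A x y + mult01 A x y'"
  "mult01 A (scale0 A c x) y = scale1 A c (mult01 A x y)"
  "mult01 A x (scale1 A c y) = scale1 A c (mult01 A x y)"
  "brack A (y + y') w = brack A y w + brack A y' w"
  "brack A w (y + y') = brack A w y + brack A w y'"
  "brack A (scale1 A c y) w = scale0 A c (brack A y w)"
  "brack A w (scale1 A c y) = scale0 A c (brack A w y)"
  using bilinear00 bilinear01 bilinear_brack by (simp_all add: bilinear_map_iff)

lemmas product_group_rules =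
  bilinear_map_group_rules[OF bilinear00]
  bilinear_map_group_rules[OF bilinear01]
  bilinear_map_group_rules[OF bilinear_brack]

lemma twist_rules:
  "twist0 A (x + x') = twist0 A x + twist0 A x'"
  "twist1 A (y + y') = twist1 A y + twist1 A y'"
  "twist0 A (scale0 A c x) = scale0 A c (twist0 A x)"
  "twist1 A (scale1 A c y) = scale1 A c (twist1 A y)"
  using linear_twist0 linear_twist1 unfolding Vector_Spaces.linear_iff by blast+

end

section \<open>Surjective homomorphisms with central kernel\<close>

locale central_quotient = E: hom_lie_antialgebra E + A: hom_lie_antialgebra A
  for E :: "('k::{alg_closed_field,field_char_0}, 'e0::ab_group_add, 'e1::ab_group_add)
      graded_hom_alg"
    and A :: "('k, 'a0::ab_group_add, 'a1::ab_group_add) graded_hom_alg"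
    and \<pi>0 :: "'e0 \<Rightarrow> 'a0" and \<pi>1 :: "'e1 \<Rightarrow> 'a1" +
  assumes hom: "hla_hom E A \<pi>0 \<pi>1"
    and surj0: "surj \<pi>0" and surj1: "surj \<pi>1"
    and kernel0: "\<pi>0 x = 0 \<Longrightarrow> x \<in> center0 E"
    and kernel1: "\<pi>1 y = 0 \<Longrightarrow> y \<in> center1 E"
begin

lemma proj_rules:
  "\<pi>0 (x + x') = \<pi>0 x + \<pi>0 x'" "\<pi>1 (y + y') = \<pi>1 y + \<pi>1 y'"
  "\<pi>0 (scale0 E c x) = scale0 A c (\<pi>0 x)" "\<pi>1 (scale1 E c y) = scale1 A c (\<pi>1 y)"
  "\<pi>0 (twist0 E x) = twist0 A (\<pi>0 x)" "\<pi>1 (twist1 E y) = twist1 A (\<pi>1 y)"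
  "\<pi>0 (mult00 E x x') = mult00 A (\<pi>0 x) (\<pi>0 x')"
  "\<pi>1 (mult01 E x y) = mult01 A (\<pi>0 x) (\<pi>1 y)"
  "\<pi>0 (brack E y y') = brack A (\<pi>1 y) (\<pi>1 y')"
  using hom unfolding hla_hom_def Vector_Spaces.linear_iff by blast+

lemma proj_diff: "\<pi>0 (x - x') = \<pi>0 x - \<pi>0 x'" "\<pi>1 (y - y') = \<pi>1 y - \<pi>1 y'"
  using proj_rules(1)[of "x - x'" x'] proj_rules(2)[of "y - y'" y'] by (simp_all add: algebra_simps)

text \<open>A set-theoretic section chosen by \<open>inv\<close>. All that is used of it later is
  \<open>proj_lift\<close>.\<close>

definition lift0 :: "'a0 \<Rightarrow> 'e0" where "lift0 = inv \<pi>0"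
definition lift1 :: "'a1 \<Rightarrow> 'e1" where "lift1 = inv \<pi>1"

lemma proj_lift [simp]: "\<pi>0 (lift0 x) = x" "\<pi>1 (lift1 y) = y"
  by (simp_all add: lift0_def lift1_def surj0 surj1 surj_f_inv_f)

text \<open>The difference of two elements with equal image lies in the kernel, hence in the center,
  so it annihilates every factor.\<close>

lemma product_cong:
  assumes "\<pi>0 x = \<pi>0 x'"
  shows "mult00 E x z = mult00 E x' z" "mult01 E x y = mult01 E x' y"
proof -
  have "x - x' \<in> center0 E" by (rule kernel0) (simp add: proj_diff assms)
  then show "mult00 E x z = mult00 E x' z" "mult01 E x y = mult01 E x' y"
    by (simp_all add: center0_def E.product_group_rules)
qed

lemma product_cong_odd:
  assumes "\<pi>1 y = \<pi>1 y'"
  shows "mult01 E x y = mult01 E x y'" "brack E y w = brack E y' w"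
proof -
  have "y - y' \<in> center1 E" by (rule kernel1) (simp add: proj_diff assms)
  then show "mult01 E x y = mult01 E x y'" "brack E y w = brack E y' w"
    by (simp_all add: center1_def E.product_group_rules)
qed

text \<open>Reading the linearity rules of \<open>E\<close> backwards gathers each right-hand side
  into one product. Both sides then differ only in a left factor with the same image under
  \<open>\<pi>0\<close>, so \<open>product_cong\<close> applies. Thus lifts behave linearly and
  multiplicatively once they are multiplied with something.\<close>

lemma lift0_products:
  fixes z :: 'e0 and w :: 'e1
  shows
  "mult00 E (lift0 (\<pi>0 e)) z = mult00 E e z"
  "mult00 E (lift0 (x + x')) z = mult00 E (lift0 x) z + mult00 E (lift0 x') z"
  "mult00 E (lift0 (scale0 A c x)) z = scale0 E c (mult00 E (lift0 x) z)"
  "mult00 E (lift0 (twist0 A x)) z = mult00 E (twist0 E (lift0 x)) z"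
  "mult00 E (lift0 (mult00 A x x')) z = mult00 E (mult00 E (lift0 x) (lift0 x')) z"
  "mult00 E (lift0 (brack A y y')) z = mult00 E (brack E (lift1 y) (lift1 y')) z"
  "mult01 E (lift0 (\<pi>0 e)) w = mult01 E e w"
  "mult01 E (lift0 (x + x')) w = mult01 E (lift0 x) w + mult01 E (lift0 x') w"
  "mult01 E (lift0 (scale0 A c x)) w = scale1 E c (mult01 E (lift0 x) w)"
  "mult01 E (lift0 (twist0 A x)) w = mult01 E (twist0 E (lift0 x)) w"
  "mult01 E (lift0 (mult00 A x x')) w = mult01 E (mult00 E (lift0 x) (lift0 x')) w"
  "mult01 E (lift0 (brack A y y')) w = mult01 E (brack E (lift1 y) (lift1 y')) w"
  unfolding E.product_rules(1,3,5,7)[symmetric] by (rule product_cong; simp add: proj_rules)+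

lemma lift1_products:
  fixes z :: 'e0 and w :: 'e1
  shows
  "mult01 E z (lift1 (\<pi>1 e)) = mult01 E z e"
  "mult01 E z (lift1 (y + y')) = mult01 E z (lift1 y) + mult01 E z (lift1 y')"
  "mult01 E z (lift1 (scale1 A c y)) = scale1 E c (mult01 E z (lift1 y))"
  "mult01 E z (lift1 (twist1 A y)) = mult01 E z (twist1 E (lift1 y))"
  "mult01 E z (lift1 (mult01 A x y)) = mult01 E z (mult01 E (lift0 x) (lift1 y))"
  "brack E (lift1 (\<pi>1 e)) w = brack E e w"
  "brack E (lift1 (y + y')) w = brack E (lift1 y) w + brack E (lift1 y') w"
  "brack E (lift1 (scale1 A c y)) w = scale0 E c (brack E (lift1 y) w)"
  "brack E (lift1 (twist1 A y)) w = brack E (twist1 E (lift1 y)) w"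
  "brack E (lift1 (mult01 A x y)) w = brack E (mult01 E (lift0 x) (lift1 y)) w"
  unfolding E.product_rules(6,8,9,11)[symmetric] by (rule product_cong_odd; simp add: proj_rules)+

section \<open>The action of \<open>A\<close> on \<open>E\<close> through lifts\<close>

definition act0 :: "'a0 \<Rightarrow> 'e0 \<times> 'e1 \<Rightarrow> 'e0 \<times> 'e1"
  where "act0 x = (\<lambda>(u, v). (mult00 E (lift0 x) u, mult01 E (lift0 x) v))"

text \<open>The odd lift stands on the right of \<open>u\<close> because \<open>mult01\<close> takes
  the even factor first; supercommutativity brings no sign here.\<close>

definition act1 :: "'a1 \<Rightarrow> 'e0 \<times> 'e1 \<Rightarrow> 'e0 \<times> 'e1"
  where "act1 y = (\<lambda>(u, v). (brack E (lift1 y) v, mult01 E u (lift1 y)))"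

lemma comp_act:
  "comp00 (act0 x) u = mult00 E (lift0 x) u"
  "comp11 (act0 x) v = mult01 E (lift0 x) v"
  "comp01 (act1 y) u = mult01 E u (lift1 y)"
  "comp10 (act1 y) v = brack E (lift1 y) v"
  by (simp_all add: comp00_def comp11_def comp01_def comp10_def act0_def act1_def)

lemmas lift_products = lift0_products lift1_products
lemmas E_rules = E.product_rules E.product_group_rules E.scale_rules E.twist_rules
lemmas A_rules = A.product_rules A.product_group_rules A.scale_rules A.twist_rules

lemma mult00_left_swap:
  "mult00 E (twist0 E x) (mult00 E y z) = mult00 E (twist0 E y) (mult00 E x z)"
  by (metis E.hom_assoc00 E.mult00_commute)

text \<open>The Hom-Jacobi identity solved for one summand. With a lift for \<open>y\<close> this is
  the action axiom for \<open>\<rho>1\<close> on brackets.\<close>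

lemma hom_jacobi_solved:
  "mult01 E (brack E v1 v2) (twist1 E y)
    = mult01 E (brack E y v2) (twist1 E v1) - mult01 E (brack E y v1) (twist1 E v2)"
  using E.hom_jacobi[of v1 v2 y] E.brack_skew[of v2 y]
  by (simp add: E.product_group_rules algebra_simps)

text \<open>The same identity with \<open>v\<close> moved to the second bracket slot by skew
  symmetry, which is where \<open>act1\<close> puts module elements.\<close>

lemma brack_mult_twist:
  "mult01 E (brack E y y') (twist1 E v)
    = mult01 E (brack E y v) (twist1 E y') - mult01 E (brack E y' v) (twist1 E y)"
  by (simp add: hom_jacobi_solved[of y y' v] E.brack_skew[of v] E.product_group_rules)

text \<open>In the second component each monomial has one argument from the module, and all others
  are lifts. So every axiom splits into axioms of \<open>E\<close>, one for each slot that the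
  module element can occupy.\<close>

lemma semidirect_act:
  "hom_lie_antialgebra (semidirect A (scale0 E) (scale1 E) (twist0 E) (twist1 E) act0 act1)"
  (is "hom_lie_antialgebra ?S")
proof -
  have v0: "vector_space (scale0 ?S)" and v1: "vector_space (scale1 ?S)"
    by (simp_all add: semidirect_def vector_space_prod_scale
        A.vector_space0 A.vector_space1 E.vector_space0 E.vector_space1)
  note S = semidirect_def comp_act prod_scale_def lift_products E_rules A_rules
  show ?thesis
  proof (rule hom_lie_antialgebra.intro)
    show "vector_space (scale0 ?S)" "vector_space (scale1 ?S)" by (fact v0 v1)+
    show "bilinear_map (scale0 ?S) (scale0 ?S) (scale0 ?S) (mult00 ?S)"
      unfolding bilinear_map_iff using v0 by (auto simp: S algebra_simps)
    show "bilinear_map (scale0 ?S) (scale1 ?S) (scale1 ?S) (mult01 ?S)"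
      unfolding bilinear_map_iff using v0 v1 by (auto simp: S algebra_simps)
    show "bilinear_map (scale1 ?S) (scale1 ?S) (scale0 ?S) (brack ?S)"
      unfolding bilinear_map_iff using v0 v1 by (auto simp: S algebra_simps)
    show "Vector_Spaces.linear (scale0 ?S) (scale0 ?S) (twist0 ?S)"
      unfolding Vector_Spaces.linear_iff using v0 by (auto simp: S)
    show "Vector_Spaces.linear (scale1 ?S) (scale1 ?S) (twist1 ?S)"
      unfolding Vector_Spaces.linear_iff using v1 by (auto simp: S)
    fix x1' x2' x3' :: "'a0 \<times> 'e0" and y1' y2' y3' :: "'a1 \<times> 'e1"
    obtain x1 u1 x2 u2 x3 u3 where x: "x1' = (x1, u1)" "x2' = (x2, u2)" "x3' = (x3, u3)"
      by (metis surj_pair)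
    obtain y1 v1 y2 v2 y3 v3 where y: "y1' = (y1, v1)" "y2' = (y2, v2)" "y3' = (y3, v3)"
      by (metis surj_pair)
    show "mult00 ?S x1' x2' = mult00 ?S x2' x1'"
      by (simp add: x semidirect_def A.mult00_commute add.commute)
    show "brack ?S y1' y2' = - brack ?S y2' y1'"
      by (simp add: y semidirect_def A.brack_skew[of y1 y2])
    \<comment> \<open>The terms in \<open>u3\<close> agree by Hom-associativity, those in
      \<open>u2\<close> by \<open>mult00_left_swap\<close>, and those in \<open>u1\<close> by
      Hom-associativity after commuting the lifts of \<open>x2\<close> and
      \<open>x3\<close>.\<close>
    show "mult00 ?S (twist0 ?S x1') (mult00 ?S x2' x3')
        = mult00 ?S (mult00 ?S x1' x2') (twist0 ?S x3')"
      by (simp add: x S A.hom_assoc00 E.hom_assoc00[symmetric] mult00_left_swap[of "lift0 x3"]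
          E.mult00_commute[of "lift0 x2" "lift0 x3"] add.assoc)
    show "mult01 ?S (twist0 ?S x1') (mult01 ?S x2' y1')
        = scale1 ?S (1/2) (mult01 ?S (mult00 ?S x1' x2') (twist1 ?S y1'))"
      by (simp add: x y S A.hom_assoc01 E.hom_assoc01 E.mult00_commute[of u1] add.assoc)
    \<comment> \<open>The terms in \<open>u1\<close> need the even product commuted before the
      derivation rule applies, and one bracket flipped so that the twisted lift comes first.\<close>
    show "mult00 ?S (twist0 ?S x1') (brack ?S y1' y2')
        = brack ?S (mult01 ?S x1' y1') (twist1 ?S y2')
          + brack ?S (twist1 ?S y1') (mult01 ?S x1' y2')"
      by (simp add: x y S A.hom_derivation E.hom_derivation
          E.mult00_commute[of "brack E (lift1 y1) (lift1 y2)"]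
          E.brack_skew[of "mult01 E u1 (lift1 y1)"])
    \<comment> \<open>Expanding the three products of two lifts with a twisted \<open>v1\<close>,
      \<open>v2\<close> or \<open>v3\<close> gives six terms that cancel the remaining six. What is
      left is the Hom-Jacobi identity of \<open>A\<close>.\<close>
    show "mult01 ?S (brack ?S y2' y3') (twist1 ?S y1')
        + mult01 ?S (brack ?S y3' y1') (twist1 ?S y2')
        + mult01 ?S (brack ?S y1' y2') (twist1 ?S y3') = 0"
      by (simp add: y S zero_prod_def
          brack_mult_twist[of "lift1 y2" "lift1 y3" v1]
          brack_mult_twist[of "lift1 y3" "lift1 y1" v2]
          brack_mult_twist[of "lift1 y1" "lift1 y2" v3])
        (use A.hom_jacobi[of y2 y3 y1] in \<open>simp add: ac_simps\<close>)
  qed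
qed

text \<open>Linearity in the acting element comes from \<open>lift_products\<close>, as the lifts
  themselves need not be linear.\<close>

lemma representation_act:
  "representation A (scale0 E) (scale1 E) (twist0 E) (twist1 E) act0 act1"
  unfolding representation_def bilinear_map_iff
  using A.hom_lie_antialgebra_axioms semidirect_act
  by (auto simp: act0_def act1_def vector_space_prod_scale prod_scale_def lift_products E_rules
      A.vector_space0 A.vector_space1 E.vector_space0 E.vector_space1
      E.linear_twist0 E.linear_twist1)

lemma action_act: "hla_action A E act0 act1"
  unfolding hla_action_def comp_act lift_products
proof (intro conjI allI)
  fix x :: 'a0 and y :: 'a1 and u u' :: 'e0 and v v' :: 'e1
  let ?x = "lift0 x" and ?y = "lift1 y"
  show "hom_lie_antialgebra A" "hom_lie_antialgebra E"
    by (fact A.hom_lie_antialgebra_axioms E.hom_lie_antialgebra_axioms)+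
  show "Defs.representation A (scale0 E) (scale1 E) (twist0 E) (twist1 E) act0 act1"
    by (fact representation_act)
  show "mult00 E (twist0 E ?x) (mult00 E u u') = mult00 E (mult00 E ?x u) (twist0 E u')"
    by (fact E.hom_assoc00)
  show "mult01 E (twist0 E ?x) (mult01 E u v)
      = scale1 E (1/2) (mult01 E (mult00 E ?x u) (twist1 E v))"
    by (fact E.hom_assoc01)
  show "mult01 E (twist0 E u) (mult01 E u' ?y)
      = scale1 E (1/2) (mult01 E (mult00 E u u') (twist1 E ?y))"
    by (fact E.hom_assoc01)
  \<comment> \<open>Hom-associativity yields the product of \<open>u\<close> with the lift, in the
    opposite order.\<close>
  show "mult01 E (twist0 E u) (mult01 E ?x v)
      = scale1 E (1/2) (mult01 E (mult00 E ?x u) (twist1 E v))"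
    by (simp add: E.hom_assoc01 E.mult00_commute)
  show "mult00 E (twist0 E ?x) (brack E v v')
      = brack E (mult01 E ?x v) (twist1 E v') + brack E (twist1 E v) (mult01 E ?x v')"
    by (fact E.hom_derivation)
  \<comment> \<open>The derivation rule for \<open>u\<close>, the lift and \<open>v\<close>, solved
    for its last summand.\<close>
  show "brack E (twist1 E ?y) (mult01 E u v)
      = mult00 E (twist0 E u) (brack E ?y v) - brack E (mult01 E u ?y) (twist1 E v)"
    by (simp add: E.hom_derivation)
  show "mult01 E (brack E v v') (twist1 E ?y)
      = mult01 E (brack E ?y v') (twist1 E v) - mult01 E (brack E ?y v) (twist1 E v')"
    by (fact hom_jacobi_solved)
qed

text \<open>Equivariance holds because the projection is multiplicative and undoes lifts. The
  remaining identities hold because \<open>e\<close> and the lift of its image give the same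
  products.\<close>

lemma crossed_module_proj: "crossed_module E A act0 act1 \<pi>0 \<pi>1"
  unfolding crossed_module_def
  using action_act hom by (simp add: comp_act proj_rules lift_products)

end

theorem proposition3p5:
  fixes V :: "('k::{alg_closed_field,field_char_0}, 'v0::ab_group_add, 'v1::ab_group_add)
      graded_hom_alg"
    and A :: "('k, 'a0::ab_group_add, 'a1::ab_group_add) graded_hom_alg"
    and E :: "('k, 'e0::ab_group_add, 'e1::ab_group_add) graded_hom_alg"
    and i0 :: "'v0 \<Rightarrow> 'e0" and i1 :: "'v1 \<Rightarrow> 'e1"
    and \<pi>0 :: "'e0 \<Rightarrow> 'a0" and \<pi>1 :: "'e1 \<Rightarrow> 'a1"
  assumes "hom_lie_antialgebra V"
    and "hom_lie_antialgebra A"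
    and "hom_lie_antialgebra E"
    and "central_extension V E A i0 i1 \<pi>0 \<pi>1"
  shows "\<exists>\<rho>0 \<rho>1. hla_action A E \<rho>0 \<rho>1 \<and> crossed_module E A \<rho>0 \<rho>1 \<pi>0 \<pi>1"
proof -
  \<comment> \<open>Exactness identifies the kernels of the projections with the ranges of
    \<open>i0\<close> and \<open>i1\<close>, which are central.\<close>
  interpret central_quotient E A \<pi>0 \<pi>1
    using assms(4) unfolding central_extension_def
    by (intro central_quotient.intro central_quotient_axioms.intro) auto
  show ?thesis
    using action_act crossed_module_proj by blast
qed

end
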